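(* Let $\mathfrak X$ be an infinite countable set, let $\alpha$ be a probability measure on $\mathfrak X$ and let $M>0$. Let $\mathbf P_0$ be a probability measure on $\mathfrak X$ and let $(X_n)_{n\ge1}$ be an i.i.d. sequence with law $\mathbf P_0$. Then for almost every realization $(x_n)_{n\ge1}$ of this sequence (that is, for $\mathbf P_0^{\otimes\mathbb N^*}$-almost every sequence), we have $$\big\|Post_n(x_1,\dots,x_n)-\mathbf P_{(x_1,\dots,x_n)}\big\|_{Tot.Var.}\longrightarrow 0\quad\text{in law as } n\to\infty.$$
   Context: $\mathfrak X$ carries the $\sigma$-algebra of all its subsets. For two probability measures, $\|Q-Q'\|_{Tot.Var.}=\sup_{C\subset\mathfrak X}|Q(C)-Q'(C)|$. For a probability measure $\alpha$ on $\mathfrak X$ and $M>0$, $DP(\alpha,M)$ denotes the Dirichlet process with mean measure $\alpha$ and concentration parameter $M$, i.e. the random probability measure with the law of $\sum_{i\in\mathbb N}\beta_i\delta_{Y_i}$, where $(Y_i)_{i\in\mathbb N}$ is i.i.d. with law $\alpha$, $\beta_i=V_i\prod_{j\le i-1}(1-V_j)$, and $(V_i)_{i\in\mathbb N}$ is i.i.d. with law $Beta(1,M)$, independent of $(Y_i)_{i\in\mathbb N}$. For $x_1,\dots,x_n\in\mathfrak X$ let $\mathbf P_{(x_1,\dots,x_n)}=\frac1n\sum_{i=1}^n\delta_{x_i}$, $\theta_n=\frac{M}{M+n}$ and $\alpha_{(x_1,\dots,x_n)}=\theta_n\alpha+(1-\theta_n)\mathbf P_{(x_1,\dots,x_n)}$.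 The (version of the) posterior of the Dirichlet process prior $DP(\alpha,M)$ given the observed sample is $Post_n(x_1,\dots,x_n):=DP(\alpha_{(x_1,\dots,x_n)},M+n)$, viewed as a random probability measure for fixed $(x_1,\dots,x_n)$. *)

theory Defs
  imports "HOL-Probability.Probability"
begin

text \<open>The Beta law is carried by the closed unit interval rather than by the real line, so that the
  stick-breaking weights are nonnegative with sum at most 1 at every point of the sample space.\<close>

definition beta_distribution :: "real \<Rightarrow> real \<Rightarrow> real measure" where
  "beta_distribution a b =
     density (restrict_space lborel {0..1})
       (\<lambda>t. ennreal (t powr (a - 1) * (1 - t) powr (b - 1) / Beta a b))"

definition stick_weight :: "(nat \<Rightarrow> real) \<Rightarrow> nat \<Rightarrow> real" where
  "stick_weight v i = v i * (\<Prod>j<i. 1 - v j)"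

definition stick_measure :: "'a measure \<Rightarrow> (nat \<Rightarrow> 'a) \<Rightarrow> (nat \<Rightarrow> real) \<Rightarrow> 'a measure" where
  "stick_measure \<alpha> y v =
     measure_of (space \<alpha>) (sets \<alpha>) (\<lambda>C. \<Sum>i. ennreal (stick_weight v i) * indicator C (y i))"

text \<open>The Dirichlet process is represented by its law. The weights sum to 1 only almost surely, hence
  the law is placed on the Giry space of sub-probability measures, where it is concentrated on
  the probability measures.\<close>

definition dirichlet_process :: "'a measure \<Rightarrow> real \<Rightarrow> 'a measure measure" where
  "dirichlet_process \<alpha> M =
     distr (PiM (UNIV :: nat set) (\<lambda>_. \<alpha>) \<Otimes>\<^sub>M PiM (UNIV :: nat set) (\<lambda>_. beta_distribution 1 M))
       (subprob_algebra \<alpha>) (\<lambda>(y, v). stick_measure \<alpha> y v)"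

text \<open>The sample consists of \<open>x 1, \<dots>, x n\<close>; the value \<open>x 0\<close> is never used.\<close>

definition empirical_measure :: "'a set \<Rightarrow> nat \<Rightarrow> (nat \<Rightarrow> 'a) \<Rightarrow> 'a measure" where
  "empirical_measure X n x =
     measure_of X (Pow X) (\<lambda>C. ennreal (1 / real n * (\<Sum>i=1..n. indicator C (x i))))"

definition posterior_mean :: "'a measure \<Rightarrow> real \<Rightarrow> nat \<Rightarrow> (nat \<Rightarrow> 'a) \<Rightarrow> 'a measure" where
  "posterior_mean \<alpha> M n x =
     (let \<theta> = M / (M + real n) in
      measure_of (space \<alpha>) (sets \<alpha>)
        (\<lambda>C. ennreal (\<theta> * measure \<alpha> C + (1 - \<theta>) * measure (empirical_measure (space \<alpha>) n x) C)))"

definition Post :: "'a measure \<Rightarrow> real \<Rightarrow> nat \<Rightarrow> (nat \<Rightarrow> 'a) \<Rightarrow> 'a measure measure" where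
  "Post \<alpha> M n x = dirichlet_process (posterior_mean \<alpha> M n x) (M + real n)"

definition tv_dist :: "'a set \<Rightarrow> 'a measure \<Rightarrow> 'a measure \<Rightarrow> real" where
  "tv_dist X Q Q' = (SUP C\<in>Pow X. \<bar>measure Q C - measure Q' C\<bar>)"

lemma prob_space_beta_distribution:
  assumes "a > 0" "b > 0"
  shows "prob_space (beta_distribution a b)"
proof
  have B: "Beta a b > 0" using assms by (simp add: Beta_def Gamma_real_pos)
  have hi: "((\<lambda>t. t powr (a - 1) * (1 - t) powr (b - 1) / Beta a b) has_integral 1) {0..1}"
    using has_integral_divide[OF has_integral_Beta_real[OF assms], of "Beta a b"] B by simp
  have "emeasure (beta_distribution a b) (space (beta_distribution a b)) =
     (\<integral>\<^sup>+t. ennreal (t powr (a - 1) * (1 - t) powr (b - 1) / Beta a b) \<partial>restrict_space lborel {0..1})"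
  proof -
    let ?R = "restrict_space lborel {0..1::real}"
    let ?g = "\<lambda>t. ennreal (t powr (a - 1) * (1 - t) powr (b - 1) / Beta a b)"
    have "?g \<in> borel_measurable ?R" by (rule measurable_restrict_space1) measurable
    then have "emeasure (density ?R ?g) (space ?R) = (\<integral>\<^sup>+t. ?g t * indicator (space ?R) t \<partial>?R)"
      by (rule emeasure_density) (rule sets.top)
    also have "\<dots> = (\<integral>\<^sup>+t. ?g t \<partial>?R)"
      by (intro nn_integral_cong) auto
    finally show ?thesis by (simp add: beta_distribution_def)
  qed
  also have "\<dots> = (\<integral>\<^sup>+t. ennreal (t powr (a - 1) * (1 - t) powr (b - 1) / Beta a b) * indicator {0..1} t \<partial>lborel)"
    by (subst nn_integral_restrict_space) auto
  also have "\<dots> = (\<integral>\<^sup>+t. ennreal (t powr (a - 1) * (1 - t) powr (b - 1) / Beta a b * indicator {0..1} t) \<partial>lborel)"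
    by (intro nn_integral_cong) (auto simp: indicator_def)
  also have "\<dots> = ennreal 1"
    using nn_integral_has_integral_lebesgue[OF _ hi] B by (simp add: mult.commute)
  finally show "emeasure (beta_distribution a b) (space (beta_distribution a b)) = 1" by simp
qed

lemma stick_weight_partial_sum: "(\<Sum>i<n. stick_weight v i) = 1 - (\<Prod>j<n. 1 - v j)"
  by (induction n) (auto simp: stick_weight_def algebra_simps)

lemma stick_weight_nonneg: "(\<And>i. v i \<in> {0..1}) \<Longrightarrow> stick_weight v i \<ge> 0"
  unfolding stick_weight_def by (intro mult_nonneg_nonneg prod_nonneg) auto

lemma emeasure_stick_measure:
  assumes "C \<in> sets \<alpha>"
  shows "emeasure (stick_measure \<alpha> y v) C = (\<Sum>i. ennreal (stick_weight v i) * indicator C (y i))"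
proof (rule emeasure_measure_of[OF stick_measure_def])
  show "sets \<alpha> \<subseteq> Pow (space \<alpha>)" by (rule sets.space_closed)
  show "C \<in> sets (stick_measure \<alpha> y v)" using assms by (simp add: stick_measure_def)
  show "positive (sets (stick_measure \<alpha> y v)) (\<lambda>C. \<Sum>i. ennreal (stick_weight v i) * indicator C (y i))"
    by (simp add: positive_def)
  show "countably_additive (sets (stick_measure \<alpha> y v)) (\<lambda>C. \<Sum>i. ennreal (stick_weight v i) * indicator C (y i))"
  proof (rule countably_additiveI)
    fix A :: "nat \<Rightarrow> 'a set"
    assume d: "disjoint_family A"
    have "(\<Sum>k. \<Sum>i. ennreal (stick_weight v i) * indicator (A k) (y i))
        = (\<Sum>i. \<Sum>k. ennreal (stick_weight v i) * indicator (A k) (y i))"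
      using nn_integral_suminf[of "\<lambda>k i. ennreal (stick_weight v i) * indicator (A k) (y i)" "count_space UNIV"]
      by (simp add: nn_integral_count_space_nat)
    also have "\<dots> = (\<Sum>i. ennreal (stick_weight v i) * indicator (\<Union>k. A k) (y i))"
      by (simp add: suminf_indicator[OF d])
    finally show "(\<Sum>k. \<Sum>i. ennreal (stick_weight v i) * indicator (A k) (y i)) =
      (\<Sum>i. ennreal (stick_weight v i) * indicator (\<Union>k. A k) (y i))" .
  qed
qed

lemma measurable_stick_measure:
  assumes "prob_space \<alpha>"
  shows "(\<lambda>(y, v). stick_measure \<alpha> y v) \<in>
    PiM (UNIV :: nat set) (\<lambda>_. \<alpha>) \<Otimes>\<^sub>M PiM (UNIV :: nat set) (\<lambda>_. beta_distribution 1 M)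
      \<rightarrow>\<^sub>M subprob_algebra \<alpha>"
proof -
  have id_meas: "(\<lambda>x. x) \<in> beta_distribution 1 M \<rightarrow>\<^sub>M borel"
    unfolding beta_distribution_def by (auto intro: measurable_restrict_space1)
  show ?thesis
  proof (rule measurable_subprob_algebra, goal_cases)
    case (1 p)
    obtain y v where p: "p = (y, v)" by fastforce
    have v: "v i \<in> {0..1}" for i
      using 1 by (auto simp: p space_pair_measure space_PiM PiE_iff beta_distribution_def space_restrict_space)
    have le: "(\<Sum>i<n. stick_weight v i) \<le> 1" for n
      unfolding stick_weight_partial_sum using v by (simp add: prod_nonneg)
    have "(\<Sum>i. ennreal (stick_weight v i) * indicator (space \<alpha>) (y i)) \<le> (\<Sum>i. ennreal (stick_weight v i))"
      by (intro suminf_le) (auto simp: indicator_def)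
    also have "\<dots> \<le> 1"
    proof (rule suminf_le_const)
      fix n show "(\<Sum>i<n. ennreal (stick_weight v i)) \<le> 1"
        using le[of n] stick_weight_nonneg[OF v] by (simp add: sum_ennreal)
    qed auto
    finally have *: "(\<Sum>i. ennreal (stick_weight v i) * indicator (space \<alpha>) (y i)) \<le> 1" .
    have sp: "space (stick_measure \<alpha> y v) = space \<alpha>" by (simp add: stick_measure_def sets.space_closed space_measure_of)
    show ?case unfolding p prod.case
    proof (rule subprob_spaceI)
      show "emeasure (stick_measure \<alpha> y v) (space (stick_measure \<alpha> y v)) \<le> 1"
        unfolding sp using * by (simp add: emeasure_stick_measure)
      show "space (stick_measure \<alpha> y v) \<noteq> {}" using sp prob_space.not_empty[OF assms] by simp
    qed
  next
    case (2 p)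
    then show ?case by (auto simp: stick_measure_def split: prod.splits)
  next
    case (3 A)
    note [measurable] = 3
    have [measurable]: "(\<lambda>p. snd p i) \<in> PiM (UNIV :: nat set) (\<lambda>_. \<alpha>) \<Otimes>\<^sub>M PiM (UNIV :: nat set) (\<lambda>_. beta_distribution 1 M) \<rightarrow>\<^sub>M borel" for i
      by (rule measurable_compose[OF _ id_meas]) measurable
    have "(\<lambda>p. \<Sum>i. ennreal (stick_weight (snd p) i) * indicator A (fst p i)) \<in> borel_measurable
       (PiM (UNIV :: nat set) (\<lambda>_. \<alpha>) \<Otimes>\<^sub>M PiM (UNIV :: nat set) (\<lambda>_. beta_distribution 1 M))"
      unfolding stick_weight_def by measurable
    then show ?case by (simp add: emeasure_stick_measure[OF 3] case_prod_beta)
  qed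
qed

lemma prob_space_dirichlet_process:
  assumes "prob_space \<alpha>" "M > 0"
  shows "prob_space (dirichlet_process \<alpha> M)"
proof -
  interpret A: prob_space \<alpha> by fact
  interpret B: prob_space "beta_distribution 1 M" using assms by (intro prob_space_beta_distribution) auto
  interpret PA: product_prob_space "\<lambda>_::nat. \<alpha>" UNIV ..
  interpret PB: product_prob_space "\<lambda>_::nat. beta_distribution 1 M" UNIV ..
  interpret P: pair_prob_space "PiM (UNIV :: nat set) (\<lambda>_. \<alpha>)" "PiM (UNIV :: nat set) (\<lambda>_. beta_distribution 1 M)" ..
  show ?thesis unfolding dirichlet_process_def
    by (intro P.prob_space_distr measurable_stick_measure assms)
qed

lemma emeasure_empirical_measure:
  assumes "C \<subseteq> X"
  shows "emeasure (empirical_measure X n x) C = ennreal (1 / real n * (\<Sum>i=1..n. indicator C (x i)))"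
proof (rule emeasure_measure_of[OF empirical_measure_def])
  let ?f = "\<lambda>C. ennreal (1 / real n * (\<Sum>i=1..n. indicator C (x i)))"
  have f: "?f C = ennreal (1 / real n) * (\<Sum>i=1..n. indicator C (x i))" for C
    by (subst ennreal_mult) (auto simp: sum_nonneg sum_ennreal[symmetric] ennreal_indicator simp del: sum_ennreal)
  show "countably_additive (sets (empirical_measure X n x)) ?f"
    unfolding f
    by (auto intro!: countably_additiveI simp: suminf_sum suminf_indicator)
qed (use assms in \<open>auto simp: empirical_measure_def positive_def\<close>)

lemma prob_space_empirical_measure:
  assumes "\<And>i. i \<in> {1..n} \<Longrightarrow> x i \<in> X" "n > 0"
  shows "prob_space (empirical_measure X n x)"
proof
  have "space (empirical_measure X n x) = X" by (simp add: empirical_measure_def space_measure_of_conv)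
  then show "emeasure (empirical_measure X n x) (space (empirical_measure X n x)) = 1"
    using assms by (simp add: emeasure_empirical_measure)
qed

lemma emeasure_posterior_mean:
  assumes "prob_space \<alpha>" "sets \<alpha> = Pow (space \<alpha>)" "M > 0" "C \<subseteq> space \<alpha>"
  shows "emeasure (posterior_mean \<alpha> M n x) C = ennreal (M / (M + real n) * measure \<alpha> C
     + (1 - M / (M + real n)) * (1 / real n * (\<Sum>i=1..n. indicator C (x i))))"
proof -
  interpret prob_space \<alpha> by fact
  have me: "measure (empirical_measure (space \<alpha>) n x) C = 1 / real n * (\<Sum>i=1..n. indicator C (x i))"
    if "C \<subseteq> space \<alpha>" for C
    using that by (simp add: measure_def emeasure_empirical_measure sum_nonneg)
  let ?t = "M / (M + real n)"
  have t: "0 \<le> ?t" "?t \<le> 1" using assms by auto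
  let ?E = "empirical_measure (space \<alpha>) n x"
  have fin: "emeasure ?E C = ennreal (measure ?E C)" if "C \<subseteq> space \<alpha>" for C
    using that me[OF that] by (simp add: emeasure_empirical_measure)
  let ?f = "\<lambda>C. ennreal (?t * measure \<alpha> C + (1 - ?t) * measure ?E C)"
  have f: "?f C = ennreal ?t * emeasure \<alpha> C + ennreal (1 - ?t) * emeasure ?E C" if "C \<subseteq> space \<alpha>" for C
    unfolding fin[OF that] emeasure_eq_measure using t by (subst ennreal_plus) (auto simp: ennreal_mult simp del: times_divide_eq_left)
  have sE: "sets ?E = Pow (space \<alpha>)"
    by (simp add: empirical_measure_def sigma_algebra.sigma_sets_eq[OF sigma_algebra_Pow])
  have "emeasure (posterior_mean \<alpha> M n x) C = ?f C"
  proof (rule emeasure_measure_of[OF posterior_mean_def[unfolded Let_def]])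
    have sP: "sets (posterior_mean \<alpha> M n x) = Pow (space \<alpha>)"
      by (simp add: posterior_mean_def Let_def flip: assms(2))
    show "C \<in> sets (posterior_mean \<alpha> M n x)" using assms(4) sP by simp
    show "countably_additive (sets (posterior_mean \<alpha> M n x)) ?f"
    proof (rule countably_additiveI, goal_cases)
      case (1 A)
      then have s: "A i \<subseteq> space \<alpha>" "(\<Union>i. A i) \<subseteq> space \<alpha>" for i
        using sP by auto
      have ss: "range A \<subseteq> sets \<alpha>" "range A \<subseteq> sets ?E" using s assms(2) sE by auto
      have "(\<Sum>i. ?f (A i)) = (\<Sum>i. ennreal ?t * emeasure \<alpha> (A i) + ennreal (1 - ?t) * emeasure ?E (A i))"
        using f[OF s(1)] by simp
      also have "\<dots> = ennreal ?t * emeasure \<alpha> (\<Union>i. A i) + ennreal (1 - ?t) * emeasure ?E (\<Union>i. A i)"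
        using suminf_emeasure[OF ss(1) 1(2)] suminf_emeasure[OF ss(2) 1(2)]
        by (simp flip: suminf_add)
      also have "\<dots> = ?f (\<Union>i. A i)" using f[OF s(2)] by simp
      finally show ?case .
    qed
  qed (auto simp: positive_def sets.space_closed)
  then show ?thesis by (simp add: me assms)
qed

end

theory Submission
  imports Defs "HOL-Real_Asymp.Real_Asymp"
begin

text \<open>
  The key estimate is that a Dirichlet process \<open>Q\<close> with mean \<open>\<alpha>\<close> and concentration \<open>M\<close> satisfies
  \<open>E \<bar>Q C - \<alpha> C\<bar> \<le> 1 / sqrt (M + 1)\<close> for every measurable \<open>C\<close>
  (\<open>dirichlet_process_mean_abs_deviation\<close>). Indeed \<open>Q C - \<alpha> C\<close> is, up to a vanishing remainder, the
  sum of the stick weights times the independent centred variables \<open>1_C (Y i) - \<alpha> C\<close>. Its second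
  moment is therefore at most the expected sum of the squared weights, a geometric series with sum
  \<open>1 / (M + 1)\<close>.

  The posterior has concentration \<open>M + n\<close>, and its mean differs from the empirical measure by at most
  \<open>M / (M + n)\<close> on every set. On any fixed finite partition of \<open>X\<close> the posterior therefore becomes
  close to the empirical measure in expectation. To pass from finite partitions to the total
  variation distance, take the partition into the points of a finite set \<open>F\<close> and its complement. By
  \<open>tv_dist_le_finite_partition\<close> the only additional cost is the empirical mass of \<open>X - F\<close>, so that
  the expected distance is at most
  \<open>(card F + 1) * (M / (M + n) + 1 / sqrt (M + n + 1))\<close> plus this mass
  (\<open>posterior_expected_tv_dist_le\<close>).

  Almost surely, the empirical measures are tight: for every \<open>e > 0\<close> some finite \<open>F\<close> makes the
  empirical mass of \<open>X - F\<close> smaller than \<open>e\<close> for all large \<open>n\<close> (\<open>AE_empirical_measures_tight\<close>). For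
  such samples the expected distance tends to 0, hence so does the distance in probability, and
  convergence in probability to a constant is convergence in law.
\<close>

section \<open>Independent coordinates of product measures\<close>

text \<open>By the characterisation of independence through the joint law, this is the fact that the
  identity map has law \<open>PiM I N\<close>, whose marginals are the \<open>N i\<close>.\<close>

lemma indep_vars_coordinates_PiM:
  assumes "\<And>i. i \<in> I \<Longrightarrow> prob_space (N i)" "I \<noteq> {}"
  shows "prob_space.indep_vars (PiM I N) N (\<lambda>i x. x i) I"
proof -
  interpret prob_space "PiM I N" by (rule prob_space_PiM) (rule assms)
  have "distr (PiM I N) (PiM I N) (\<lambda>x. \<lambda>i\<in>I. x i) = distr (PiM I N) (PiM I N) (\<lambda>x. x)"
    by (intro distr_cong) (auto simp: space_PiM PiE_restrict restrict_def PiE_def extensional_def)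
  also have "\<dots> = PiM I (\<lambda>i. distr (PiM I N) (N i) (\<lambda>x. x i))"
    using assms by (auto intro!: PiM_cong simp: distr_PiM_component)
  finally show ?thesis
    using assms(2) by (subst indep_vars_iff_distr_eq_PiM') auto
qed

lemma expectation_prod_coordinates:
  fixes g :: "'i \<Rightarrow> 'a \<Rightarrow> real"
  assumes N: "prob_space N" and J: "finite J"
    and g: "\<And>j. j \<in> J \<Longrightarrow> integrable N (g j)"
  shows "(\<integral>x. (\<Prod>j\<in>J. g j (x j)) \<partial>PiM UNIV (\<lambda>_. N)) = (\<Prod>j\<in>J. \<integral>t. g j t \<partial>N)"
proof -
  interpret prob_space "PiM UNIV (\<lambda>_::'i. N)" by (rule prob_space_PiM) (rule N)
  have g': "g j \<in> borel_measurable N" if "j \<in> J" for j using g that by auto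
  have d: "distr (PiM UNIV (\<lambda>_::'i. N)) N (\<lambda>x. x j) = N" for j
    using N by (intro distr_PiM_component) auto
  have "indep_vars (\<lambda>_. N) (\<lambda>i x. x i) J"
    using indep_vars_subset[OF indep_vars_coordinates_PiM[of UNIV "\<lambda>_. N"]] N by auto
  then have "indep_vars (\<lambda>_. borel) (\<lambda>j x. g j (x j)) J"
    by (rule indep_vars_compose2) (rule g')
  moreover have "integrable (PiM UNIV (\<lambda>_. N)) (\<lambda>x. g j (x j))" if "j \<in> J" for j
    using integrable_distr_eq[of "\<lambda>x. x j" "PiM UNIV (\<lambda>_. N)" N "g j"] g[OF that] g'[OF that] d by simp
  ultimately have "(\<integral>x. (\<Prod>j\<in>J. g j (x j)) \<partial>PiM UNIV (\<lambda>_. N)) = (\<Prod>j\<in>J. \<integral>x. g j (x j) \<partial>PiM UNIV (\<lambda>_. N))"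
    using J by (intro indep_vars_lebesgue_integral) auto
  also have "\<dots> = (\<Prod>j\<in>J. \<integral>t. g j t \<partial>N)"
  proof (rule prod.cong[OF refl])
    fix j assume "j \<in> J"
    show "(\<integral>x. g j (x j) \<partial>PiM UNIV (\<lambda>_. N)) = (\<integral>t. g j t \<partial>N)"
      using integral_distr[of "\<lambda>x. x j" "PiM UNIV (\<lambda>_. N)" N "g j"] g'[OF \<open>j \<in> J\<close>] d by simp
  qed
  finally show ?thesis .
qed

text \<open>The centred variables \<open>f (y i)\<close> are independent, hence orthogonal, so the mixed terms of the
  square vanish.\<close>

lemma expectation_square_weighted_sum_le:
  fixes w :: "nat \<Rightarrow> real"
  assumes \<alpha>: "prob_space \<alpha>" and f: "f \<in> borel_measurable \<alpha>" "\<And>y. \<bar>f y\<bar> \<le> 1"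
    and f0: "(\<integral>y. f y \<partial>\<alpha>) = 0"
  shows "(\<integral>y. (\<Sum>i<N. w i * f (y i))\<^sup>2 \<partial>PiM UNIV (\<lambda>_::nat. \<alpha>)) \<le> (\<Sum>i<N. (w i)\<^sup>2)"
proof (induction N)
  case (Suc N)
  let ?P = "PiM UNIV (\<lambda>_::nat. \<alpha>)" and ?S = "\<lambda>y. \<Sum>i<N. w i * f (y i)"
  interpret A: prob_space \<alpha> by (rule \<alpha>)
  interpret prob_space ?P by (rule prob_space_PiM) (rule \<alpha>)
  note [measurable] = f(1)
  have S: "\<bar>?S y\<bar> \<le> (\<Sum>i<N. \<bar>w i\<bar>)" for y
    by (rule order_trans[OF sum_abs]) (auto intro!: sum_mono simp: abs_mult mult_left_le f)
  have iS: "integrable ?P (\<lambda>y. (?S y)\<^sup>2)"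
    by (rule integrable_const_bound[of _ "(\<Sum>i<N. \<bar>w i\<bar>)\<^sup>2"])
      (use S in \<open>auto intro!: AE_I2 simp: abs_le_square_iff[symmetric]\<close>)
  have iff: "integrable ?P (\<lambda>y. f (y i) * f (y j))" for i j
    by (rule integrable_const_bound[of _ 1]) (auto intro!: AE_I2 mult_le_one f simp: abs_mult)
  have fint: "integrable \<alpha> f"
    by (rule A.integrable_const_bound[of _ 1]) (auto intro!: AE_I2 f)
  have orth: "(\<integral>y. f (y i) * f (y N) \<partial>?P) = 0" if "i < N" for i
    using expectation_prod_coordinates[OF \<alpha>, of "{i, N}" "\<lambda>_. f"] fint f0 that by simp
  have "(\<integral>y. (\<Sum>i<Suc N. w i * f (y i))\<^sup>2 \<partial>?P) =
     (\<integral>y. (?S y)\<^sup>2 + (\<Sum>i<N. 2 * w N * w i * (f (y i) * f (y N))) + (w N)\<^sup>2 * (f (y N) * f (y N)) \<partial>?P)"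
  proof (intro Bochner_Integration.integral_cong refl)
    fix y
    have "(\<Sum>i<N. 2 * w N * w i * (f (y i) * f (y N))) = 2 * ?S y * (w N * f (y N))"
      by (simp add: sum_distrib_left sum_distrib_right mult_ac)
    then show "(\<Sum>i<Suc N. w i * f (y i))\<^sup>2 =
        (?S y)\<^sup>2 + (\<Sum>i<N. 2 * w N * w i * (f (y i) * f (y N))) + (w N)\<^sup>2 * (f (y N) * f (y N))"
      by (simp add: power2_sum power_mult_distrib power2_eq_square[of "f (y N)"])
  qed
  also have "\<dots> = (\<integral>y. (?S y)\<^sup>2 \<partial>?P) + (w N)\<^sup>2 * (\<integral>y. f (y N) * f (y N) \<partial>?P)"
    using iS iff orth by simp
  also have "(\<integral>y. f (y N) * f (y N) \<partial>?P) \<le> (\<integral>y. 1 \<partial>?P)"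
    by (intro integral_mono iff integrable_const)
      (metis abs_mult abs_ge_zero abs_le_D1 f(2) mult_le_one)
  then have "(w N)\<^sup>2 * (\<integral>y. f (y N) * f (y N) \<partial>?P) \<le> (w N)\<^sup>2"
    by (simp add: prob_space mult_left_le)
  finally show ?case using Suc.IH by simp
qed simp

section \<open>Moments of the stick weights\<close>

lemma space_beta_distribution [simp]: "space (beta_distribution a b) = {0..1}"
  by (simp add: beta_distribution_def space_restrict_space)

lemma borel_measurable_beta_distribution:
  assumes "f \<in> borel_measurable borel"
  shows "f \<in> borel_measurable (beta_distribution a b)"
  using assms unfolding beta_distribution_def by (auto intro: measurable_restrict_space1)

text \<open>Multiplying the density \<open>M (1 - t) powr (M - 1)\<close> by \<open>(1 - t) ^ k\<close> only shifts its exponent, so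
  the moments of \<open>1 - t\<close> are quotients of Beta functions. They suffice for all moments used below.\<close>

lemma expectation_beta_one_minus_power:
  assumes M: "M > 0"
  shows "(\<integral>t. (1 - t) ^ k \<partial>beta_distribution 1 M) = M / (M + real k)"
proof -
  have B: "Beta 1 b = 1 / b" if "b > 0" for b :: real
    using that Gamma_plus1[of b] by (simp add: Beta_def Gamma_eq_zero_iff nonpos_Ints_def field_simps)
  have "has_bochner_integral (beta_distribution 1 M) (\<lambda>t. (1 - t) ^ k) (M / (M + real k))"
  proof (rule has_bochner_integral_nn_integral)
    let ?h = "\<lambda>t::real. ennreal (t powr (1 - 1) * (1 - t) powr (M - 1) / Beta 1 M)"
    have h: "?h \<in> borel_measurable (restrict_space lborel {0..1})"
      by (rule measurable_restrict_space1) measurable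
    have hi: "((\<lambda>t. M * (t powr (1 - 1) * (1 - t) powr (M + real k - 1))) has_integral M * Beta 1 (M + real k)) {0..1}"
      using M by (intro has_integral_mult_right has_integral_Beta_real) auto
    have "(\<integral>\<^sup>+t. ennreal ((1 - t) ^ k) \<partial>beta_distribution 1 M) = 
      (\<integral>\<^sup>+t. ?h t * ennreal ((1 - t) ^ k) \<partial>restrict_space lborel {0..1})"
      unfolding beta_distribution_def by (rule nn_integral_density[OF h])
        (auto intro: measurable_restrict_space1)
    also have "\<dots> = (\<integral>\<^sup>+t. ?h t * ennreal ((1 - t) ^ k) * indicator {0..1} t \<partial>lborel)"
      by (subst nn_integral_restrict_space) auto
    also have "\<dots> = (\<integral>\<^sup>+t. ennreal (M * (t powr (1 - 1) * (1 - t) powr (M + real k - 1)) * indicator {0..1} t) \<partial>lborel)"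
    proof (intro nn_integral_cong)
      fix t :: real
      \<comment> \<open>At \<open>t = 1\<close> both sides are 0, since \<open>0 powr a = 0\<close> for every exponent.\<close>
      have "(1 - t) powr (M - 1) * (1 - t) ^ k = (1 - t) powr (M + real k - 1)" if "t \<in> {0..1}"
      proof (cases "t = 1")
        case False
        with that have "(1 - t) ^ k = (1 - t) powr real k" by (simp add: powr_realpow)
        then show ?thesis by (simp add: powr_add[symmetric] algebra_simps)
      qed simp
      then show "?h t * ennreal ((1 - t) ^ k) * indicator {0..1} t =
        ennreal (M * (t powr (1 - 1) * (1 - t) powr (M + real k - 1)) * indicator {0..1} t)"
        using M by (auto simp: B indicator_def ennreal_mult[symmetric] mult_ac)
    qed
    also have "\<dots> = ennreal (M * Beta 1 (M + real k))"
      using nn_integral_has_integral_lebesgue[OF _ hi] M by (simp add: mult.commute)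
    finally show "(\<integral>\<^sup>+t. ennreal ((1 - t) ^ k) \<partial>beta_distribution 1 M) = ennreal (M / (M + real k))"
      using M by (simp add: B)
  qed (use M in \<open>auto intro: borel_measurable_beta_distribution\<close>)
  then show ?thesis by (rule has_bochner_integral_integral_eq)
qed

lemma integrable_beta_bounded:
  assumes "M > 0" "f \<in> borel_measurable borel" "\<And>t. t \<in> {0..1} \<Longrightarrow> \<bar>f t\<bar> \<le> (1::real)"
  shows "integrable (beta_distribution 1 M) f"
proof -
  interpret prob_space "beta_distribution 1 M" using assms by (intro prob_space_beta_distribution) auto
  show ?thesis using assms
    by (intro integrable_const_bound[of _ 1] borel_measurable_beta_distribution) (auto intro!: AE_I2)
qed

lemma expectation_beta_square:
  assumes M: "M > 0"
  shows "(\<integral>t. t ^ 2 \<partial>beta_distribution 1 M) = 2 / ((M + 1) * (M + 2))"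
proof -
  interpret prob_space "beta_distribution 1 M" using assms by (intro prob_space_beta_distribution) auto
  have i: "integrable (beta_distribution 1 M) (\<lambda>t. (1 - t) ^ k)" for k :: nat
    by (rule integrable_beta_bounded[OF M]) (auto simp: power_le_one)
  have "(\<integral>t. t ^ 2 \<partial>beta_distribution 1 M) = (\<integral>t. (1 - 2 * (1 - t) ^ 1) + (1 - t) ^ 2 \<partial>beta_distribution 1 M)"
    by (intro Bochner_Integration.integral_cong) (auto simp: power2_eq_square algebra_simps)
  also have "\<dots> = (\<integral>t. 1 - 2 * (1 - t) ^ 1 \<partial>beta_distribution 1 M) + (\<integral>t. (1 - t) ^ 2 \<partial>beta_distribution 1 M)"
    by (intro Bochner_Integration.integral_add Bochner_Integration.integrable_diff integrable_mult_right i
        integrable_const)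
  also have "(\<integral>t. 1 - 2 * (1 - t) ^ 1 \<partial>beta_distribution 1 M)
      = 1 - 2 * (\<integral>t. (1 - t) ^ 1 \<partial>beta_distribution 1 M)"
    using Bochner_Integration.integral_diff[OF integrable_const integrable_mult_right[OF i], of 1 2 1]
      integral_mult_right_zero[of "beta_distribution 1 M" 2 "\<lambda>t. (1 - t) ^ 1"] prob_space
    by simp
  also have "\<dots> + (\<integral>t. (1 - t) ^ 2 \<partial>beta_distribution 1 M) = 1 - 2 * (M / (M + real 1)) + M / (M + real 2)"
    by (simp only: expectation_beta_one_minus_power[OF M])
  also have "\<dots> = 2 / ((M + 1) * (M + 2))"
    using M by (simp add: divide_simps) (simp add: algebra_simps)
  finally show ?thesis .
qed

lemma expectation_stick_residual:
  assumes M: "M > 0"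
  shows "(\<integral>v. (\<Prod>j<N. 1 - v j) \<partial>PiM UNIV (\<lambda>_::nat. beta_distribution 1 M)) = (M / (M + 1)) ^ N"
proof -
  have "(\<integral>v. (\<Prod>j\<in>{..<N}. (1 - v j)) \<partial>PiM UNIV (\<lambda>_::nat. beta_distribution 1 M))
      = (\<Prod>j<N. \<integral>t. 1 - t \<partial>beta_distribution 1 M)"
    using M by (intro expectation_prod_coordinates integrable_beta_bounded prob_space_beta_distribution) auto
  then show ?thesis using expectation_beta_one_minus_power[OF M, of 1] by simp
qed

lemma expectation_stick_weight_square:
  assumes M: "M > 0"
  shows "(\<integral>v. (stick_weight v i)\<^sup>2 \<partial>PiM UNIV (\<lambda>_::nat. beta_distribution 1 M))
    = 2 / ((M + 1) * (M + 2)) * (M / (M + 2)) ^ i"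
proof -
  let ?g = "\<lambda>j t::real. if j = i then t\<^sup>2 else (1 - t)\<^sup>2"
  have w: "(stick_weight v i)\<^sup>2 = (\<Prod>j\<in>{..i}. ?g j (v j))" for v
  proof -
    have "(\<Prod>j\<in>{..i}. ?g j (v j)) = (v i)\<^sup>2 * (\<Prod>j<i. (1 - v j)\<^sup>2)"
      unfolding lessThan_Suc_atMost[symmetric] lessThan_Suc by (subst prod.insert) auto
    then show ?thesis by (simp add: stick_weight_def power_mult_distrib prod_power_distrib)
  qed
  have "(\<integral>v. (stick_weight v i)\<^sup>2 \<partial>PiM UNIV (\<lambda>_::nat. beta_distribution 1 M))
    = (\<Prod>j\<in>{..i}. \<integral>t. ?g j t \<partial>beta_distribution 1 M)"
    unfolding w using M
    by (intro expectation_prod_coordinates integrable_beta_bounded prob_space_beta_distribution)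
      (auto simp: power_le_one)
  also have "\<dots> = (\<integral>t. t\<^sup>2 \<partial>beta_distribution 1 M) * (\<Prod>j<i. \<integral>t. (1 - t)\<^sup>2 \<partial>beta_distribution 1 M)"
    unfolding lessThan_Suc_atMost[symmetric] lessThan_Suc by (subst prod.insert) auto
  finally show ?thesis
    using expectation_beta_square[OF M] expectation_beta_one_minus_power[OF M, of 2] by simp
qed

text \<open>The expected squares form a geometric series with ratio \<open>M / (M + 2)\<close>, whose full sum is
  \<open>1 / (M + 1)\<close>. This quantity is the source of the concentration of the Dirichlet process: for
  large \<open>M\<close> the mass is spread over many sticks.\<close>

lemma sum_expectation_stick_weight_square_le:
  assumes M: "M > 0"
  shows "(\<Sum>i<N. \<integral>v. (stick_weight v i)\<^sup>2 \<partial>PiM UNIV (\<lambda>_::nat. beta_distribution 1 M)) \<le> 1 / (M + 1)"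
proof -
  have "(\<Sum>i<N. \<integral>v. (stick_weight v i)\<^sup>2 \<partial>PiM UNIV (\<lambda>_::nat. beta_distribution 1 M))
    = 1 / (M + 1) * (2 / (M + 2) * (\<Sum>i<N. (M / (M + 2)) ^ i))"
    by (simp add: expectation_stick_weight_square[OF M] sum_distrib_left mult_ac)
  also have "2 / (M + 2) * (\<Sum>i<N. (M / (M + 2)) ^ i) = 1 - (M / (M + 2)) ^ N"
  proof -
    have "2 / (M + 2) = 1 - M / (M + 2)" using M by (simp add: field_simps)
    then show ?thesis by (simp only: one_diff_power_eq)
  qed
  also have "1 / (M + 1) * (1 - (M / (M + 2)) ^ N) \<le> 1 / (M + 1)"
    using M by (intro mult_left_le) auto
  finally show ?thesis .
qed

section \<open>Concentration of the Dirichlet process around its mean\<close>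

text \<open>Truncating the series at \<open>N\<close> loses at most the unbroken part \<open>\<Prod>j<N. 1 - v j\<close> of the
  stick. This explicit remainder reduces all integrals over the random measure to integrals of finite
  sums and products.\<close>

lemma measure_stick_measure_sandwich:
  assumes v: "\<And>i. v i \<in> {0..1}" and C: "C \<in> sets \<alpha>"
  shows "(\<Sum>i<N. stick_weight v i * indicator C (y i)) \<le> measure (stick_measure \<alpha> y v) C"
    and "measure (stick_measure \<alpha> y v) C
      \<le> (\<Sum>i<N. stick_weight v i * indicator C (y i)) + (\<Prod>j<N. 1 - v j)"
proof -
  let ?b = "\<lambda>i. stick_weight v i * indicator C (y i)"
  note w = stick_weight_nonneg[of v, OF v]
  have b: "0 \<le> ?b i" "?b i \<le> stick_weight v i" for i
    using w[of i] by (auto simp: indicator_def)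
  have tail: "(\<Sum>i<n. ?b i) \<le> (\<Sum>i<N. ?b i) + (\<Prod>j<N. 1 - v j)" for n
  proof (cases "n \<le> N")
    case True
    then have "(\<Sum>i<n. ?b i) \<le> (\<Sum>i<N. ?b i)" by (intro sum_mono2) (auto simp: b)
    moreover have "0 \<le> (\<Prod>j<N. 1 - v j)" using v by (intro prod_nonneg) auto
    ultimately show ?thesis by simp
  next
    case False
    then have s: "sum f {..<n} = sum f {..<N} + sum f {N..<n}" for f :: "nat \<Rightarrow> real"
      by (subst sum.union_disjoint[symmetric]) (auto intro!: sum.cong)
    have "sum ?b {N..<n} \<le> sum (stick_weight v) {N..<n}" by (intro sum_mono b)
    also have "\<dots> = (\<Prod>j<N. 1 - v j) - (\<Prod>j<n. 1 - v j)"
      using s[of "stick_weight v"] by (simp add: stick_weight_partial_sum)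
    also have "\<dots> \<le> (\<Prod>j<N. 1 - v j)" using v by (simp add: prod_nonneg)
    finally show ?thesis using s[of ?b] by simp
  qed
  have sm: "summable ?b"
    by (rule summableI_nonneg_bounded[OF b(1) tail])
  have "emeasure (stick_measure \<alpha> y v) C = (\<Sum>i. ennreal (?b i))"
    unfolding emeasure_stick_measure[OF C]
    by (intro suminf_cong) (simp add: indicator_def)
  also have "\<dots> = ennreal (suminf ?b)" by (rule suminf_ennreal2[OF b(1) sm])
  finally have m: "measure (stick_measure \<alpha> y v) C = suminf ?b"
    by (simp add: measure_def suminf_nonneg sm b)
  show "(\<Sum>i<N. ?b i) \<le> measure (stick_measure \<alpha> y v) C"
    unfolding m by (rule sum_le_suminf[OF sm]) (auto simp: b)
  show "measure (stick_measure \<alpha> y v) C \<le> (\<Sum>i<N. ?b i) + (\<Prod>j<N. 1 - v j)"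
    unfolding m by (rule suminf_le_const[OF sm tail])
qed

text \<open>Since the first \<open>N\<close> weights sum to one minus the unbroken part, centring each indicator at
  \<open>p\<close> changes the truncated series by \<open>p\<close> up to \<open>p\<close> times the unbroken part. This error and the
  truncation error are both nonnegative and enter with opposite signs, so their difference is still
  at most the unbroken part.\<close>

lemma measure_stick_measure_deviation:
  assumes v: "\<And>i. v i \<in> {0..1}" and C: "C \<in> sets \<alpha>" and p: "p \<in> {0..1}"
  shows "\<bar>measure (stick_measure \<alpha> y v) C - p\<bar>
    \<le> \<bar>\<Sum>i<N. stick_weight v i * (indicator C (y i) - p)\<bar> + (\<Prod>j<N. 1 - v j)"
proof -
  let ?R = "\<Prod>j<N. 1 - v j"
  have R: "0 \<le> ?R" using v by (intro prod_nonneg) auto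
  have "(\<Sum>i<N. stick_weight v i * (indicator C (y i) - p)) =
    (\<Sum>i<N. stick_weight v i * indicator C (y i)) - p * (1 - ?R)"
    by (simp add: stick_weight_partial_sum[symmetric] right_diff_distrib sum_subtractf sum_distrib_left mult.commute[of p])
  moreover have "0 \<le> p * ?R" "p * ?R \<le> ?R" using p R by (auto simp: mult_left_le_one_le)
  ultimately show ?thesis
    using measure_stick_measure_sandwich[of v C \<alpha> y N, OF v C] unfolding right_diff_distrib by linarith
qed

text \<open>The variance of \<open>\<bar>f\<bar>\<close> is nonnegative.\<close>

lemma (in prob_space) expectation_abs_le_sqrt:
  fixes f :: "'a \<Rightarrow> real"
  assumes "integrable M f" "integrable M (\<lambda>x. (f x)\<^sup>2)" "(\<integral>x. (f x)\<^sup>2 \<partial>M) \<le> c"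
  shows "(\<integral>x. \<bar>f x\<bar> \<partial>M) \<le> sqrt c"
proof -
  have "0 \<le> variance (\<lambda>x. \<bar>f x\<bar>)" by (rule variance_positive)
  also have "variance (\<lambda>x. \<bar>f x\<bar>) = (\<integral>x. (f x)\<^sup>2 \<partial>M) - (\<integral>x. \<bar>f x\<bar> \<partial>M)\<^sup>2"
    using assms by (subst variance_eq) auto
  finally show ?thesis using assms(3) by (intro real_le_rsqrt) simp
qed

text \<open>Conditionally on the sticks, the truncated centred series has second moment at most the sum of
  the squared weights, which is at most \<open>1 / (M + 1)\<close> on average. The remainder contributes
  \<open>(M / (M + 1)) ^ N\<close>, which vanishes as \<open>N\<close> grows.\<close>

lemma dirichlet_process_mean_abs_deviation:
  assumes \<alpha>: "prob_space \<alpha>" and M: "M > 0" and C: "C \<in> sets \<alpha>"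
  shows "(\<integral>Q. \<bar>measure Q C - measure \<alpha> C\<bar> \<partial>dirichlet_process \<alpha> M) \<le> 1 / sqrt (M + 1)"
proof -
  interpret A: prob_space \<alpha> by fact
  let ?B = "beta_distribution 1 M"
  interpret B: prob_space ?B using M by (intro prob_space_beta_distribution) auto
  let ?PA = "PiM (UNIV :: nat set) (\<lambda>_. \<alpha>)" and ?PB = "PiM (UNIV :: nat set) (\<lambda>_. ?B)"
  interpret PA: product_prob_space "\<lambda>_::nat. \<alpha>" UNIV ..
  interpret PB: product_prob_space "\<lambda>_::nat. ?B" UNIV ..
  interpret P: pair_prob_space ?PA ?PB ..
  let ?P = "?PA \<Otimes>\<^sub>M ?PB"
  let ?p = "measure \<alpha> C"
  define f where "f y = indicator C y - ?p" for y
  define Z where "Z N y v = (\<Sum>i<N. stick_weight v i * f (y i))" for N y v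
  define R where "R N v = (\<Prod>j<N. 1 - v j)" for N and v :: "nat \<Rightarrow> real"
  have p: "?p \<in> {0..1}" by simp
  have vB: "v i \<in> {0..1}" if "v \<in> space ?PB" for v i
    using that by (auto simp: space_PiM PiE_iff)
  have f: "\<bar>f y\<bar> \<le> 1" for y using p by (auto simp: f_def indicator_def)
  have fm [measurable]: "f \<in> borel_measurable \<alpha>" unfolding f_def using C by measurable
  have f0: "(\<integral>y. f y \<partial>\<alpha>) = 0"
    unfolding f_def using C A.prob_space
    by (subst Bochner_Integration.integral_diff) (auto simp: A.emeasure_eq_measure)
  have [measurable]: "(\<lambda>v. v i) \<in> borel_measurable ?PB" for i
    by (rule measurable_compose[of _ _ ?B, OF _ borel_measurable_beta_distribution]) auto
  have wm [measurable]: "(\<lambda>v. stick_weight v i) \<in> borel_measurable ?PB" for i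
    unfolding stick_weight_def by measurable
  have [measurable]: "R N \<in> borel_measurable ?PB" for N unfolding R_def by measurable
  have Zm [measurable]: "(\<lambda>(y, v). Z N y v) \<in> borel_measurable ?P" for N
    unfolding Z_def by measurable
  have w: "0 \<le> stick_weight v i" "stick_weight v i \<le> 1" if "v \<in> space ?PB" for v i
    using stick_weight_nonneg[of v] vB[OF that]
    by (auto simp: stick_weight_def intro!: mult_le_one prod_nonneg prod_le_1)
  have R01: "0 \<le> R N v" "R N v \<le> 1" if "v \<in> space ?PB" for N v
    using vB[OF that] by (auto simp: R_def intro!: prod_nonneg prod_le_1)
  have Zb: "\<bar>Z N y v\<bar> \<le> real N" if "v \<in> space ?PB" for N y v
  proof -
    have "\<bar>Z N y v\<bar> \<le> (\<Sum>i<N. \<bar>stick_weight v i * f (y i)\<bar>)" unfolding Z_def by (rule sum_abs)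
    also have "\<dots> \<le> (\<Sum>i<N. 1)"
      using w[OF that] f by (intro sum_mono) (auto simp: abs_mult intro!: mult_le_one)
    finally show ?thesis by simp
  qed
  have iZ: "integrable ?P (\<lambda>q. Z N (fst q) (snd q))" for N
    by (rule P.integrable_const_bound[of _ "real N"])
      (use Zb Zm[of N] in \<open>auto intro!: AE_I2 simp: space_pair_measure case_prod_beta\<close>)
  have iZ2: "integrable ?P (\<lambda>q. (Z N (fst q) (snd q))\<^sup>2)" for N
    by (rule P.integrable_const_bound[of _ "(real N)\<^sup>2"])
      (use Zb Zm[of N] in \<open>auto intro!: AE_I2 power_mono simp: space_pair_measure case_prod_beta abs_le_square_iff[symmetric]\<close>)
  have iw: "integrable ?PB (\<lambda>v. (stick_weight v i)\<^sup>2)" for i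
    by (rule PB.integrable_const_bound[of _ 1]) (use w in \<open>auto intro!: AE_I2 power_le_one\<close>)
  \<comment> \<open>For fixed sticks \<open>v\<close> the weights are constants, so the orthogonality of the atoms applies to the
    inner integral.\<close>
  have Z2: "(\<integral>q. (Z N (fst q) (snd q))\<^sup>2 \<partial>?P) \<le> 1 / (M + 1)" for N
  proof -
    have i: "integrable ?P (\<lambda>(y, v). (Z N y v)\<^sup>2)" using iZ2[of N] by (simp add: split_beta')
    have "(\<integral>q. (Z N (fst q) (snd q))\<^sup>2 \<partial>?P) = (\<integral>v. (\<integral>y. (Z N y v)\<^sup>2 \<partial>?PA) \<partial>?PB)"
      using P.integral_snd[OF i] by (simp add: split_beta')
    also have "\<dots> \<le> (\<integral>v. (\<Sum>i<N. (stick_weight v i)\<^sup>2) \<partial>?PB)"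
      unfolding Z_def
      by (intro integral_mono expectation_square_weighted_sum_le \<alpha> fm f f0 Bochner_Integration.integrable_sum iw
          P.integrable_snd[OF i, unfolded Z_def])
    also have "\<dots> \<le> 1 / (M + 1)"
      using sum_expectation_stick_weight_square_le[OF M, of N] iw by simp
    finally show ?thesis .
  qed
  have Z1: "(\<integral>q. \<bar>Z N (fst q) (snd q)\<bar> \<partial>?P) \<le> 1 / sqrt (M + 1)" for N
    using P.expectation_abs_le_sqrt[OF iZ iZ2 Z2, of N] by (simp add: real_sqrt_divide)
  have stickm: "(\<lambda>(y, v). stick_measure \<alpha> y v) \<in> ?P \<rightarrow>\<^sub>M subprob_algebra \<alpha>"
    by (rule measurable_stick_measure[OF \<alpha>])
  have hm: "(\<lambda>Q. \<bar>measure Q C - ?p\<bar>) \<in> borel_measurable (subprob_algebra \<alpha>)"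
    using C by measurable
  have bnd: "(\<integral>Q. \<bar>measure Q C - ?p\<bar> \<partial>dirichlet_process \<alpha> M) \<le> 1 / sqrt (M + 1) + (M / (M + 1)) ^ N" for N
  proof -
    have iR': "integrable ?P (\<lambda>q. R N (snd q))"
      by (rule P.integrable_const_bound[of _ 1]) (use R01 in \<open>auto intro!: AE_I2 simp: space_pair_measure\<close>)
    have "(\<integral>Q. \<bar>measure Q C - ?p\<bar> \<partial>dirichlet_process \<alpha> M)
      = (\<integral>q. \<bar>measure (stick_measure \<alpha> (fst q) (snd q)) C - ?p\<bar> \<partial>?P)"
      unfolding dirichlet_process_def
      using integral_distr[OF stickm hm] by (simp add: case_prod_beta)
    also have "\<dots> \<le> (\<integral>q. \<bar>Z N (fst q) (snd q)\<bar> + R N (snd q) \<partial>?P)"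
    proof (rule integral_mono')
      show "integrable ?P (\<lambda>q. \<bar>Z N (fst q) (snd q)\<bar> + R N (snd q))" using iZ iR' by simp
      fix q assume "q \<in> space ?P"
      then have q: "snd q \<in> space ?PB" by (auto simp: space_pair_measure)
      have v: "\<And>i. snd q i \<in> {0..1}" by (rule vB[OF q])
      show "0 \<le> \<bar>Z N (fst q) (snd q)\<bar> + R N (snd q)"
        and "\<bar>measure (stick_measure \<alpha> (fst q) (snd q)) C - ?p\<bar> \<le> \<bar>Z N (fst q) (snd q)\<bar> + R N (snd q)"
        using R01(1)[OF q, of N] measure_stick_measure_deviation[of "snd q" C \<alpha> ?p "fst q" N, OF v C p]
        by (auto simp: Z_def R_def f_def)
    qed
    also have "\<dots> = (\<integral>q. \<bar>Z N (fst q) (snd q)\<bar> \<partial>?P) + (\<integral>q. R N (snd q) \<partial>?P)"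
      using iZ iR' by simp
    also have "(\<integral>q. R N (snd q) \<partial>?P) = (\<integral>v. R N v \<partial>?PB)"
      using P.integral_snd[of "\<lambda>_ v. R N v"] iR' by (simp add: split_beta' PA.P.prob_space)
    also have "\<dots> = (M / (M + 1)) ^ N"
      using expectation_stick_residual[OF M, of N] by (simp add: R_def)
    finally show ?thesis using Z1[of N] by simp
  qed
  have "(\<lambda>N. 1 / sqrt (M + 1) + (M / (M + 1)) ^ N) \<longlonglongrightarrow> 1 / sqrt (M + 1) + 0"
    using M by (intro tendsto_intros LIMSEQ_power_zero) (simp add: divide_simps)
  then show ?thesis
    using bnd by (intro LIMSEQ_le_const[of "\<lambda>N. 1 / sqrt (M + 1) + (M / (M + 1)) ^ N"]) auto
qed

section \<open>Total variation distance on a countable set\<close>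

lemma countable_incseq_finite:
  assumes "countable X"
  shows "\<exists>A :: nat \<Rightarrow> 'a set. incseq A \<and> (\<forall>n. finite (A n)) \<and> (\<Union>n. A n) = X"
proof -
  obtain f :: "'a \<Rightarrow> nat" where f: "inj_on f X" using assms by (auto simp: countable_def)
  define A where "A n = {k \<in> X. f k < n}" for n
  have "finite (A n)" for n
  proof (rule finite_imageD)
    show "finite (f ` A n)" by (rule finite_subset[of _ "{..<n}"]) (auto simp: A_def)
    show "inj_on f (A n)" by (rule inj_on_subset[OF f]) (auto simp: A_def)
  qed
  moreover have "incseq A" "(\<Union>n. A n) = X" by (auto simp: A_def incseq_def)
  ultimately show ?thesis by blast
qed

lemma abs_measure_diff_le_1:
  assumes "subprob_space Q" "subprob_space P"
  shows "\<bar>measure Q C - measure P C\<bar> \<le> 1"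
  using subprob_space.subprob_measure_le_1[OF assms(1), of C]
    subprob_space.subprob_measure_le_1[OF assms(2), of C]
    measure_nonneg[of Q C] measure_nonneg[of P C] by linarith

lemma tv_dist_nonneg:
  assumes "subprob_space Q" "subprob_space P"
  shows "0 \<le> tv_dist X Q P"
  unfolding tv_dist_def
  by (rule cSUP_upper2[of _ _ "{}"]) (auto intro!: bdd_aboveI2[of _ _ 1] abs_measure_diff_le_1 assms)

lemma tv_dist_le_1:
  assumes "subprob_space Q" "subprob_space P"
  shows "tv_dist X Q P \<le> 1"
  unfolding tv_dist_def by (rule cSUP_least) (auto intro!: abs_measure_diff_le_1 assms)

text \<open>Every subset of a countable set is an increasing union of finite subsets, along which finite
  measures converge. The finite subsets form a countable family, which is what makes the total
  variation distance a measurable function of its argument.\<close>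

lemma tv_dist_eq_SUP_finite:
  assumes X: "countable X" and Q: "subprob_space Q" "sets Q = Pow X" and P: "subprob_space P" "sets P = Pow X"
  shows "tv_dist X Q P = (SUP C\<in>{C. finite C \<and> C \<subseteq> X}. \<bar>measure Q C - measure P C\<bar>)"
proof (rule antisym)
  interpret Q: subprob_space Q by fact
  interpret P: subprob_space P by fact
  let ?d = "\<lambda>C. \<bar>measure Q C - measure P C\<bar>" and ?K = "{C. finite C \<and> C \<subseteq> X}"
  have bdd: "bdd_above (?d ` D)" for D
    by (intro bdd_aboveI2[of _ _ 1] abs_measure_diff_le_1 Q P)
  show "tv_dist X Q P \<le> Sup (?d ` ?K)"
    unfolding tv_dist_def
  proof (rule cSUP_least)
    fix C assume C: "C \<in> Pow X"
    obtain B where B: "incseq B" "\<And>n. finite (B n)" "(\<Union>n. B n) = X"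
      using countable_incseq_finite[OF X] by blast
    define A where "A n = C \<inter> B n" for n
    have U: "(\<Union>n. A n) = C" using B(3) C by (auto simp: A_def)
    have A: "range A \<subseteq> Pow X" "incseq A" using B(1) C by (auto simp: A_def incseq_def)
    have fin: "A n \<in> ?K" for n using B(2) C by (auto simp: A_def)
    have "(\<lambda>n. ?d (A n)) \<longlonglongrightarrow> ?d C"
      using Q.finite_Lim_measure_incseq[of A] P.finite_Lim_measure_incseq[of A] A Q P
      unfolding U by (intro tendsto_intros) auto
    then show "?d C \<le> Sup (?d ` ?K)"
      by (rule LIMSEQ_le_const2) (auto intro!: cSUP_upper bdd fin)
  qed auto
  show "Sup (?d ` ?K) \<le> tv_dist X Q P"
    unfolding tv_dist_def by (rule cSUP_subset_mono) (auto intro!: bdd)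
qed

lemma borel_measurable_tv_dist:
  assumes X: "countable X" and "sets \<alpha> = Pow X" and P: "subprob_space P" "sets P = Pow X"
  shows "(\<lambda>Q. tv_dist X Q P) \<in> borel_measurable (subprob_algebra \<alpha>)"
proof -
  let ?K = "{C. finite C \<and> C \<subseteq> X}"
  have "(\<lambda>Q. SUP C\<in>?K. \<bar>measure Q C - measure P C\<bar>) \<in> borel_measurable (subprob_algebra \<alpha>)"
  proof (rule borel_measurable_cSUP)
    show "countable ?K" using countable_Collect_finite_subset[OF X] .
    show "(\<lambda>Q. \<bar>measure Q C - measure P C\<bar>) \<in> borel_measurable (subprob_algebra \<alpha>)" if "C \<in> ?K" for C
    proof -
      have [measurable]: "C \<in> sets \<alpha>" using that assms by auto
      show ?thesis by measurable
    qed
    show "bdd_above ((\<lambda>C. \<bar>measure Q C - measure P C\<bar>) ` ?K)" if "Q \<in> space (subprob_algebra \<alpha>)" for Q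
      using that by (intro bdd_aboveI2[of _ _ 1] abs_measure_diff_le_1 P) (auto simp: space_subprob_algebra)
  qed
  then show ?thesis
    by (rule measurable_cong[THEN iffD2, rotated])
      (use assms in \<open>auto simp: space_subprob_algebra intro!: tv_dist_eq_SUP_finite\<close>)
qed

text \<open>Inside \<open>F\<close> a set is compared point by point. Outside \<open>F\<close> the difference is at most the larger of
  the two tail masses, and \<open>Q (X - F)\<close> is controlled by \<open>P (X - F)\<close> and one more deviation. The
  bound thus involves the deviations of \<open>Q\<close> only on finitely many fixed sets, and the tail of \<open>P\<close>
  alone.\<close>

lemma tv_dist_le_finite_partition:
  assumes Q: "subprob_space Q" "sets Q = Pow X" and P: "subprob_space P" "sets P = Pow X"
    and F: "finite F" "F \<subseteq> X"
  shows "tv_dist X Q P \<le>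
    (\<Sum>k\<in>F. \<bar>measure Q {k} - measure P {k}\<bar>) + \<bar>measure Q (X - F) - measure P (X - F)\<bar> + measure P (X - F)"
  unfolding tv_dist_def
proof (rule cSUP_least)
  interpret Q: subprob_space Q by fact
  interpret P: subprob_space P by fact
  fix C assume "C \<in> Pow X"
  then have C: "C \<subseteq> X" by auto
  have fin: "finite (C \<inter> F)" using F by auto
  have split: "measure R C = (\<Sum>k\<in>C \<inter> F. measure R {k}) + measure R (C - F)"
    and tail: "measure R (C - F) \<le> measure R (X - F)"
    if "subprob_space R" "sets R = Pow X" for R
  proof -
    interpret R: subprob_space R by fact
    have "measure R C = measure R (C \<inter> F) + measure R (C - F)"
      using C F that by (subst R.finite_measure_Union[symmetric]) (auto intro!: arg_cong[where f="measure R"])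
    also have "measure R (C \<inter> F) = (\<Sum>k\<in>C \<inter> F. measure R {k})"
      using C F that by (intro R.finite_measure_eq_sum_singleton) auto
    finally show "measure R C = (\<Sum>k\<in>C \<inter> F. measure R {k}) + measure R (C - F)" .
    show "measure R (C - F) \<le> measure R (X - F)"
      using C that by (intro R.finite_measure_mono) auto
  qed
  have "\<bar>(\<Sum>k\<in>C \<inter> F. measure Q {k}) - (\<Sum>k\<in>C \<inter> F. measure P {k})\<bar>
      \<le> (\<Sum>k\<in>C \<inter> F. \<bar>measure Q {k} - measure P {k}\<bar>)"
    unfolding sum_subtractf[symmetric] by (rule sum_abs)
  also have "\<dots> \<le> (\<Sum>k\<in>F. \<bar>measure Q {k} - measure P {k}\<bar>)"
    using F by (intro sum_mono2) auto
  finally show "\<bar>measure Q C - measure P C\<bar> \<le> (\<Sum>k\<in>F. \<bar>measure Q {k} - measure P {k}\<bar>)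
      + \<bar>measure Q (X - F) - measure P (X - F)\<bar> + measure P (X - F)"
    using split[OF Q] split[OF P] tail[OF Q] tail[OF P]
      measure_nonneg[of Q "C - F"] measure_nonneg[of P "C - F"] by linarith
qed auto

text \<open>The partition of \<open>X\<close> into the points of \<open>F\<close> and the rest has \<open>card F + 1\<close> cells. On each cell the
  deviation of \<open>Q\<close> from \<open>P\<close> splits into the random fluctuation around \<open>\<alpha>\<close> and the bias \<open>\<theta>\<close>.\<close>

lemma dirichlet_process_expected_tv_dist_le:
  assumes X: "countable X" and \<alpha>: "prob_space \<alpha>" "sets \<alpha> = Pow X" and M: "M > 0"
    and P: "prob_space P" "sets P = Pow X" and F: "finite F" "F \<subseteq> X"
    and near: "\<And>C. C \<subseteq> X \<Longrightarrow> \<bar>measure \<alpha> C - measure P C\<bar> \<le> \<theta>"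
  shows "integrable (dirichlet_process \<alpha> M) (\<lambda>Q. tv_dist X Q P)"
    and "(\<integral>Q. tv_dist X Q P \<partial>dirichlet_process \<alpha> M)
      \<le> (real (card F) + 1) * (\<theta> + 1 / sqrt (M + 1)) + measure P (X - F)"
proof -
  let ?D = "dirichlet_process \<alpha> M"
  interpret D: prob_space ?D by (rule prob_space_dirichlet_process) fact+
  interpret P: prob_space P by fact
  have P': "subprob_space P" by unfold_locales
  have sD: "sets ?D = sets (subprob_algebra \<alpha>)" by (simp add: dirichlet_process_def)
  have Q: "subprob_space Q" "sets Q = Pow X" if "Q \<in> space ?D" for Q
    using that \<alpha> sets_eq_imp_space_eq[OF sD] by (auto simp: space_subprob_algebra)
  have tvm: "(\<lambda>Q. tv_dist X Q P) \<in> borel_measurable ?D"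
    using borel_measurable_tv_dist[OF X \<alpha>(2) P' P(2)] by (simp add: measurable_cong_sets[OF sD refl])
  show int: "integrable ?D (\<lambda>Q. tv_dist X Q P)"
    by (rule D.integrable_const_bound[of _ 1])
      (use tvm in \<open>auto intro!: AE_I2 simp: tv_dist_nonneg tv_dist_le_1 Q P'\<close>)
  let ?d = "\<lambda>C Q. \<bar>measure Q C - measure P C\<bar>"
  have dm: "?d C \<in> borel_measurable ?D" if "C \<subseteq> X" for C
  proof -
    have [measurable]: "C \<in> sets \<alpha>" using that \<alpha> by auto
    show ?thesis unfolding measurable_cong_sets[OF sD refl] by measurable
  qed
  have di: "integrable ?D (?d C)" if "C \<subseteq> X" for C
    by (rule D.integrable_const_bound[of _ 1])
      (use dm[OF that] in \<open>auto intro!: AE_I2 abs_measure_diff_le_1 Q P'\<close>)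
  have d\<alpha>: "integrable ?D (\<lambda>Q. \<bar>measure Q C - measure \<alpha> C\<bar>)" if "C \<subseteq> X" for C
  proof (rule D.integrable_const_bound[of _ 1])
    interpret A: prob_space \<alpha> by fact
    have "subprob_space \<alpha>" by unfold_locales
    then show "AE Q in ?D. norm \<bar>measure Q C - measure \<alpha> C\<bar> \<le> 1"
      using Q by (auto intro!: AE_I2 abs_measure_diff_le_1)
    have [measurable]: "C \<in> sets \<alpha>" using that \<alpha> by auto
    show "(\<lambda>Q. \<bar>measure Q C - measure \<alpha> C\<bar>) \<in> borel_measurable ?D"
      unfolding measurable_cong_sets[OF sD refl] by measurable
  qed
  have Ed: "(\<integral>Q. ?d C Q \<partial>?D) \<le> \<theta> + 1 / sqrt (M + 1)" if "C \<subseteq> X" for C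
  proof -
    have "(\<integral>Q. ?d C Q \<partial>?D) \<le> (\<integral>Q. \<bar>measure Q C - measure \<alpha> C\<bar> + \<theta> \<partial>?D)"
      using near[OF that] by (intro integral_mono di that Bochner_Integration.integrable_add d\<alpha> D.integrable_const) linarith
    also have "\<dots> = (\<integral>Q. \<bar>measure Q C - measure \<alpha> C\<bar> \<partial>?D) + \<theta>"
      using d\<alpha>[OF that] by (simp add: D.prob_space)
    also have "\<dots> \<le> 1 / sqrt (M + 1) + \<theta>"
      using dirichlet_process_mean_abs_deviation[OF \<alpha>(1) M, of C] that \<alpha> by simp
    finally show ?thesis by simp
  qed
  have sub: "{k} \<subseteq> X" if "k \<in> F" for k using F that by auto
  have "(\<integral>Q. tv_dist X Q P \<partial>?D)
    \<le> (\<integral>Q. (\<Sum>k\<in>F. ?d {k} Q) + ?d (X - F) Q + measure P (X - F) \<partial>?D)"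
    by (intro integral_mono int Bochner_Integration.integrable_add Bochner_Integration.integrable_sum di sub
        D.integrable_const tv_dist_le_finite_partition Q P' P F) auto
  also have "\<dots> = (\<Sum>k\<in>F. \<integral>Q. ?d {k} Q \<partial>?D) + (\<integral>Q. ?d (X - F) Q \<partial>?D) + measure P (X - F)"
    using di[of "X - F"] di[OF sub] by (simp add: D.prob_space)
  also have "\<dots> \<le> (\<Sum>k\<in>F. \<theta> + 1 / sqrt (M + 1)) + (\<theta> + 1 / sqrt (M + 1)) + measure P (X - F)"
    by (intro add_mono sum_mono Ed sub) auto
  finally show "(\<integral>Q. tv_dist X Q P \<partial>?D)
      \<le> (real (card F) + 1) * (\<theta> + 1 / sqrt (M + 1)) + measure P (X - F)"
    unfolding sum_constant by argo
qed

section \<open>Tightness of empirical measures\<close>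

text \<open>By Hoeffding's inequality the exceptional events have geometrically small probability, so by
  the Borel-Cantelli lemma almost surely only finitely many of them occur. This is the upper
  half of the law of large numbers; it serves to bound the empirical mass of tails.\<close>

lemma AE_eventually_frequency_less:
  assumes N: "prob_space N" and C: "C \<in> sets N" and e: "e > 0"
  shows "AE x in PiM {1::nat..} (\<lambda>_. N). \<forall>\<^sub>F n in sequentially.
    1 / real n * (\<Sum>i=1..n. indicator C (x i)) < measure N C + e"
proof -
  let ?P = "PiM {1::nat..} (\<lambda>_. N)"
  interpret N: prob_space N by fact
  interpret prob_space ?P by (rule prob_space_PiM) (rule N)
  let ?I = "indicator C :: 'a \<Rightarrow> real"
  note [measurable] = C
  have d: "distr ?P N (\<lambda>x. x i) = N" if "i \<ge> 1" for i
    using N that by (intro distr_PiM_component) auto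
  have dI: "distr ?P borel (\<lambda>x. ?I (x i)) = distr N borel ?I" if "i \<ge> 1" for i
    using that distr_distr[of ?I N borel "\<lambda>x. x i" ?P] d[OF that] by (simp add: comp_def)
  have "indep_vars (\<lambda>_. N) (\<lambda>i x. x i) {1..}"
    using N by (intro indep_vars_coordinates_PiM) auto
  then have indep: "indep_vars (\<lambda>_. borel) (\<lambda>i x. ?I (x i)) {1..}"
    by (rule indep_vars_compose2) auto
  have E: "expectation (\<lambda>x. ?I (x 1)) = measure N C"
  proof -
    have "expectation (\<lambda>x. ?I (x 1)) = (\<integral>t. ?I t \<partial>distr ?P N (\<lambda>x. x 1))"
      by (subst integral_distr) auto
    then show ?thesis by (simp add: d[simplified])
  qed
  define B where "B n = {x \<in> space ?P. (\<Sum>i\<in>{1..n}. ?I (x i)) / real n \<ge> measure N C + e}" for n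
  have B [measurable]: "B n \<in> sets ?P" for n
  proof -
    have "(\<lambda>x. ?I (x i)) \<in> borel_measurable ?P" if "i \<in> {1..n}" for i
      by (rule measurable_compose[OF measurable_component_singleton]) (use that in auto)
    then have [measurable]: "(\<lambda>x. (\<Sum>i\<in>{1..n}. ?I (x i))) \<in> borel_measurable ?P"
      by (rule borel_measurable_sum)
    show ?thesis unfolding B_def by measurable
  qed
  have le: "prob (B n) \<le> exp (- 2 * e\<^sup>2) ^ n" for n
  proof (cases "n = 0")
    case False
    \<comment> \<open>The case \<open>n = 0\<close> is kept apart because Hoeffding's inequality asks for a nonempty index set.\<close>
    interpret H: Hoeffding_ineq_iid ?P "{1..n}" "\<lambda>i x. ?I (x i)" "\<lambda>x. ?I (x 1)" 0 1 "measure N C"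
    proof unfold_locales
      show "indep_vars (\<lambda>_. borel) (\<lambda>i x. ?I (x i)) {1..n}"
        by (rule indep_vars_subset[OF indep]) auto
      show "measure N C \<equiv> expectation (\<lambda>x. ?I (x 1))" using E by simp
      show "distr ?P borel (\<lambda>x. ?I (x i)) = distr ?P borel (\<lambda>x. ?I (x 1))" if "i \<in> {1..n}" for i
        using dI[of i] dI[of 1] that by auto
      show "(\<lambda>x. ?I (x 1)) \<in> borel_measurable ?P"
        by (rule measurable_compose[OF measurable_component_singleton]) auto
    qed (auto simp: indicator_def)
    have "prob (B n) \<le> exp (- 2 * real n * e\<^sup>2)"
      using H.Hoeffding_ineq_ge'[of e] e False by (simp add: B_def)
    also have "\<dots> = exp (- 2 * e\<^sup>2) ^ n" by (simp add: exp_of_nat_mult[symmetric] mult_ac)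
    finally show ?thesis .
  next
    case True
    then show ?thesis using prob_le_1[of "B n"] by simp
  qed
  have "summable (\<lambda>n. exp (- 2 * e\<^sup>2) ^ n)"
    using e by (intro summable_geometric) simp
  then have "summable (\<lambda>n. prob (B n))"
    by (rule summable_comparison_test') (use le in auto)
  then have "AE x in ?P. \<forall>\<^sub>F n in sequentially. x \<in> space ?P - B n"
    by (intro borel_cantelli_AE1 B) (simp_all add: emeasure_eq_measure del: One_nat_def)
  then show ?thesis
    by (rule AE_mp) (auto intro!: AE_I2 elim!: eventually_mono simp: B_def not_le)
qed

lemma (in finite_measure) countable_finite_exhaustion:
  assumes "countable X" "sets M = Pow X" "e > 0"
  shows "\<exists>F. finite F \<and> F \<subseteq> X \<and> measure M (X - F) < e"
proof -
  obtain A where A: "incseq A" "\<And>n. finite (A n)" "(\<Union>n. A n) = X"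
    using countable_incseq_finite[OF assms(1)] by blast
  have "(\<lambda>n. measure M (X - A n)) \<longlonglongrightarrow> measure M (\<Inter>n. X - A n)"
    using A(1) by (intro finite_Lim_measure_decseq) (auto simp: assms(2) decseq_def incseq_def)
  also have "(\<Inter>n. X - A n) = {}" using A(3) by auto
  finally have "\<forall>\<^sub>F n in sequentially. measure M (X - A n) < e"
    using order_tendstoD(2) assms(3) by fastforce
  then obtain n where "measure M (X - A n) < e"
    by (auto simp: eventually_sequentially)
  then show ?thesis using A(2,3) by (intro exI[of _ "A n"]) auto
qed

lemma measure_empirical_measure:
  assumes "C \<subseteq> X"
  shows "measure (empirical_measure X n x) C = 1 / real n * (\<Sum>i=1..n. indicator C (x i))"
  using assms by (simp add: measure_def emeasure_empirical_measure sum_nonneg)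

text \<open>The tail bound holds almost surely for each set of a fixed countable family of complements of
  finite sets, hence for all of them at once. The law \<open>N\<close> itself gives arbitrarily small mass to
  these complements.\<close>

lemma AE_empirical_measures_tight:
  assumes X: "countable X" and N: "prob_space N" "sets N = Pow X"
  shows "AE x in PiM {1::nat..} (\<lambda>_. N). \<forall>e>0. \<exists>F. finite F \<and> F \<subseteq> X \<and>
    (\<forall>\<^sub>F n in sequentially. measure (empirical_measure X n x) (X - F) < e)"
proof -
  interpret N: prob_space N by fact
  let ?P = "PiM {1::nat..} (\<lambda>_. N)"
  have "\<exists>F. finite F \<and> F \<subseteq> X \<and> measure N (X - F) < 1 / real (Suc m)" for m
    using X N by (intro N.countable_finite_exhaustion) auto
  then obtain F where F: "finite (F m)" "F m \<subseteq> X" "measure N (X - F m) < 1 / real (Suc m)" for m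
    by metis
  have "AE x in ?P. \<forall>m. \<forall>\<^sub>F n in sequentially.
      1 / real n * (\<Sum>i=1..n. indicator (X - F m) (x i)) < measure N (X - F m) + 1 / real (Suc m)"
    unfolding AE_all_countable using N by (intro allI AE_eventually_frequency_less) auto
  then show ?thesis
  proof (rule AE_mp, intro AE_I2 impI allI)
    fix x and e :: real
    assume *: "\<forall>m. \<forall>\<^sub>F n in sequentially.
      1 / real n * (\<Sum>i=1..n. indicator (X - F m) (x i)) < measure N (X - F m) + 1 / real (Suc m)"
      and e: "e > 0"
    obtain m where m: "1 / real (Suc m) < e / 2"
      using reals_Archimedean[of "e / 2"] e by (auto simp: inverse_eq_divide)
    have "\<forall>\<^sub>F n in sequentially. measure (empirical_measure X n x) (X - F m) < e"
      using *[rule_format, of m]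
    proof (rule eventually_mono)
      fix n
      assume "1 / real n * (\<Sum>i=1..n. indicator (X - F m) (x i)) < measure N (X - F m) + 1 / real (Suc m)"
      then show "measure (empirical_measure X n x) (X - F m) < e"
        using F(3)[of m] m by (subst measure_empirical_measure) auto
    qed
    then show "\<exists>F. finite F \<and> F \<subseteq> X \<and> (\<forall>\<^sub>F n in sequentially. measure (empirical_measure X n x) (X - F) < e)"
      using F by blast
  qed
qed

section \<open>Convergence in law to a point mass\<close>

text \<open>Markov's inequality gives convergence in probability to 0. The distribution function of the
  point mass at 0 jumps at 0, so convergence is tested only at the points to its left and right. The
  hypotheses are imposed for large indices, which accommodates sequences with degenerate first terms
  such as the empirical measure of an empty sample, which is zero.\<close>

lemma weak_conv_m_return_0_if_expectation_tendsto_0: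
  fixes D :: "nat \<Rightarrow> 'a measure" and f :: "nat \<Rightarrow> 'a \<Rightarrow> real"
  assumes D: "\<forall>\<^sub>F n in sequentially. prob_space (D n) \<and> integrable (D n) (f n) \<and> (\<forall>\<omega>\<in>space (D n). 0 \<le> f n \<omega>)"
    and lim: "(\<lambda>n. \<integral>\<omega>. f n \<omega> \<partial>D n) \<longlonglongrightarrow> 0"
  shows "weak_conv_m (\<lambda>n. distr (D n) borel (f n)) (return borel 0)"
  unfolding weak_conv_m_def weak_conv_def
proof (intro allI impI)
  have cdf0: "cdf (return borel 0) x = (if 0 \<le> x then 1 else 0)" for x :: real
    by (simp add: cdf_def measure_return)
  have cdfD: "cdf (distr (D n) borel (f n)) x = measure (D n) {\<omega>\<in>space (D n). f n \<omega> \<le> x}"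
    if "integrable (D n) (f n)" for n x
    using that unfolding cdf_def by (subst measure_distr) (auto intro!: arg_cong[where f="measure (D n)"])
  fix x :: real assume cont: "isCont (cdf (return borel 0)) x"
  consider "x < 0" | "x = 0" | "x > 0" by linarith
  then show "(\<lambda>n. cdf (distr (D n) borel (f n)) x) \<longlonglongrightarrow> cdf (return borel 0) x"
  proof cases
    case 1
    have "\<forall>\<^sub>F n in sequentially. cdf (distr (D n) borel (f n)) x = 0"
      using D
    proof (rule eventually_mono)
      fix n assume n: "prob_space (D n) \<and> integrable (D n) (f n) \<and> (\<forall>\<omega>\<in>space (D n). 0 \<le> f n \<omega>)"
      then have "{\<omega>\<in>space (D n). f n \<omega> \<le> x} = {}" using 1 by force
      then show "cdf (distr (D n) borel (f n)) x = 0"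
        unfolding cdfD[OF n[THEN conjunct2, THEN conjunct1]] by (simp only: measure_empty)
    qed
    then show ?thesis using 1 by (simp add: cdf0 tendsto_eventually)
  next
    case 2
    \<comment> \<open>Approach the jump from the left, where the distribution function is 0.\<close>
    have "(\<lambda>n. cdf (return borel 0) (- inverse (real (Suc n)))) \<longlonglongrightarrow> cdf (return borel 0) (- 0)"
      using cont 2 by (intro isCont_tendsto_compose[OF _ tendsto_minus[OF LIMSEQ_inverse_real_of_nat]]) simp
    then show ?thesis by (simp add: cdf0 LIMSEQ_const_iff del: of_nat_Suc)
  next
    case 3
    have bounds: "\<forall>\<^sub>F n in sequentially. 1 - (\<integral>\<omega>. f n \<omega> \<partial>D n) / x \<le> cdf (distr (D n) borel (f n)) x
        \<and> cdf (distr (D n) borel (f n)) x \<le> 1"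
      using D
    proof (rule eventually_mono)
      fix n assume n: "prob_space (D n) \<and> integrable (D n) (f n) \<and> (\<forall>\<omega>\<in>space (D n). 0 \<le> f n \<omega>)"
      then interpret prob_space "D n" by simp
      have i [measurable]: "integrable (D n) (f n)" using n by simp
      have "1 - prob {\<omega>\<in>space (D n). x \<le> f n \<omega>} = prob {\<omega>\<in>space (D n). \<not> x \<le> f n \<omega>}"
        by (subst prob_compl[symmetric]) (auto intro!: arg_cong[where f=prob])
      also have "\<dots> \<le> prob {\<omega>\<in>space (D n). f n \<omega> \<le> x}"
        by (intro finite_measure_mono) auto
      finally have "1 - prob {\<omega>\<in>space (D n). x \<le> f n \<omega>} \<le> cdf (distr (D n) borel (f n)) x"
        using cdfD[OF i] by simp
      moreover have "prob {\<omega>\<in>space (D n). x \<le> f n \<omega>} \<le> (\<integral>\<omega>. f n \<omega> \<partial>D n) / x"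
        using n 3 by (intro integral_Markov_inequality_measure[where A="{}"]) (auto intro!: AE_I2)
      ultimately show "1 - (\<integral>\<omega>. f n \<omega> \<partial>D n) / x \<le> cdf (distr (D n) borel (f n)) x
        \<and> cdf (distr (D n) borel (f n)) x \<le> 1"
        using cdfD[OF i] by simp
    qed
    have "(\<lambda>n. 1 - (\<integral>\<omega>. f n \<omega> \<partial>D n) / x) \<longlonglongrightarrow> 1 - 0 / x"
      by (intro tendsto_intros lim) (use 3 in simp)
    then have "(\<lambda>n. cdf (distr (D n) borel (f n)) x) \<longlonglongrightarrow> 1"
      using bounds unfolding eventually_conj_iff
      by (elim conjE) (rule tendsto_sandwich[OF _ _ _ tendsto_const]; simp)
    then show ?thesis using 3 by (simp add: cdf0)
  qed
qed

section \<open>The posterior of the Dirichlet process\<close>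

lemma sets_posterior_mean: "sets (posterior_mean \<alpha> M n x) = sets \<alpha>"
  by (simp add: posterior_mean_def Let_def)

lemma prob_space_posterior_mean:
  assumes "prob_space \<alpha>" "sets \<alpha> = Pow X" "M > 0" "n > 0" "\<And>i. i \<in> {1..n} \<Longrightarrow> x i \<in> X"
  shows "prob_space (posterior_mean \<alpha> M n x)"
proof
  interpret prob_space \<alpha> by fact
  have X: "space \<alpha> = X" using sets_eq_imp_space_eq[of \<alpha> "count_space X"] assms by simp
  have sp: "space (posterior_mean \<alpha> M n x) = space \<alpha>"
    by (rule sets_eq_imp_space_eq[OF sets_posterior_mean])
  show "emeasure (posterior_mean \<alpha> M n x) (space (posterior_mean \<alpha> M n x)) = 1"
    unfolding sp using assms X
    by (subst emeasure_posterior_mean) (auto simp: prob_space ennreal_plus[symmetric] simp del: ennreal_plus)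
qed

text \<open>The posterior mean is a convex combination, with the weight \<open>M / (M + n)\<close> on \<open>\<alpha>\<close>.\<close>

lemma posterior_mean_near_empirical_measure:
  assumes "prob_space \<alpha>" "sets \<alpha> = Pow X" "M > 0" "n > 0" "\<And>i. i \<in> {1..n} \<Longrightarrow> x i \<in> X" "C \<subseteq> X"
  shows "\<bar>measure (posterior_mean \<alpha> M n x) C - measure (empirical_measure X n x) C\<bar> \<le> M / (M + real n)"
proof -
  interpret prob_space \<alpha> by fact
  interpret E: prob_space "empirical_measure X n x"
    using assms by (intro prob_space_empirical_measure) auto
  have X: "space \<alpha> = X" using sets_eq_imp_space_eq[of \<alpha> "count_space X"] assms by simp
  define \<theta> where "\<theta> = M / (M + real n)"
  have \<theta>: "0 \<le> \<theta>" "\<theta> \<le> 1" using assms by (auto simp: \<theta>_def)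
  let ?m = "measure (empirical_measure X n x) C"
  have "emeasure (posterior_mean \<alpha> M n x) C = ennreal (\<theta> * measure \<alpha> C + (1 - \<theta>) * ?m)"
    using assms X by (simp add: emeasure_posterior_mean measure_empirical_measure \<theta>_def)
  then have "measure (posterior_mean \<alpha> M n x) C = \<theta> * measure \<alpha> C + (1 - \<theta>) * ?m"
    using \<theta> by (simp add: measure_def[of "posterior_mean \<alpha> M n x"] del: ennreal_plus)
  then have "measure (posterior_mean \<alpha> M n x) C - ?m = \<theta> * (measure \<alpha> C - ?m)"
    by (simp add: algebra_simps)
  moreover have "\<bar>measure \<alpha> C - ?m\<bar> \<le> 1"
    using prob_le_1[of C] E.prob_le_1[of C] measure_nonneg[of \<alpha> C]
      measure_nonneg[of "empirical_measure X n x" C] by linarith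
  ultimately show ?thesis
    using \<theta> by (simp add: abs_mult mult_left_le flip: \<theta>_def)
qed

lemma posterior_expected_tv_dist_le:
  assumes X: "countable X" and \<alpha>: "prob_space \<alpha>" "sets \<alpha> = Pow X" and M: "M > 0"
    and n: "n > 0" and x: "\<And>i. i \<in> {1..n} \<Longrightarrow> x i \<in> X" and F: "finite F" "F \<subseteq> X"
  shows "integrable (Post \<alpha> M n x) (\<lambda>Q. tv_dist X Q (empirical_measure X n x))"
    and "(\<integral>Q. tv_dist X Q (empirical_measure X n x) \<partial>Post \<alpha> M n x)
      \<le> (real (card F) + 1) * (M / (M + real n) + 1 / sqrt (M + real n + 1))
        + measure (empirical_measure X n x) (X - F)"
proof -
  have Mn: "M + real n > 0" using M by simp
  have P: "sets (posterior_mean \<alpha> M n x) = Pow X" "sets (empirical_measure X n x) = Pow X"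
    using \<alpha> by (simp_all add: sets_posterior_mean empirical_measure_def
        sigma_algebra.sigma_sets_eq[OF sigma_algebra_Pow])
  note * = dirichlet_process_expected_tv_dist_le[OF X prob_space_posterior_mean[OF \<alpha> M n x] P(1) Mn
      prob_space_empirical_measure[OF x n] P(2) F posterior_mean_near_empirical_measure[OF \<alpha> M n x]]
  show "integrable (Post \<alpha> M n x) (\<lambda>Q. tv_dist X Q (empirical_measure X n x))"
    unfolding Post_def by (rule *(1))
  show "(\<integral>Q. tv_dist X Q (empirical_measure X n x) \<partial>Post \<alpha> M n x)
      \<le> (real (card F) + 1) * (M / (M + real n) + 1 / sqrt (M + real n + 1))
        + measure (empirical_measure X n x) (X - F)"
    unfolding Post_def by (rule *(2))
qed

theorem corollary1:
  fixes X :: "'a set" and \<alpha> P0 :: "'a measure" and M :: real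
  assumes "countable X" and "infinite X"
    and "prob_space \<alpha>" and "sets \<alpha> = Pow X"
    and "M > 0"
    and "prob_space P0" and "sets P0 = Pow X"
  shows "AE x in PiM {1::nat..} (\<lambda>_. P0).
           weak_conv_m
             (\<lambda>n. distr (Post \<alpha> M n x) borel (\<lambda>Q. tv_dist X Q (empirical_measure X n x)))
             (return borel 0)"
  using AE_empirical_measures_tight[OF assms(1,6,7)]
proof (rule AE_mp, intro AE_I2 impI)
  note \<alpha> = assms(3,4) and M = \<open>M > 0\<close>
  fix x assume x: "x \<in> space (PiM {1::nat..} (\<lambda>_. P0))"
    and tight: "\<forall>e>0. \<exists>F. finite F \<and> F \<subseteq> X \<and>
      (\<forall>\<^sub>F n in sequentially. measure (empirical_measure X n x) (X - F) < e)"
  have "space P0 = X" using sets_eq_imp_space_eq[of P0 "count_space X"] assms by simp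
  then have xX: "x i \<in> X" if "i \<ge> 1" for i
    using x that by (auto simp: space_PiM PiE_iff)
  have int: "integrable (Post \<alpha> M n x) (\<lambda>Q. tv_dist X Q (empirical_measure X n x))" if "n > 0" for n
    by (rule posterior_expected_tv_dist_le(1)[OF assms(1) \<alpha> M that _ finite.emptyI]) (auto intro: xX)
  have nonneg: "0 \<le> tv_dist X Q (empirical_measure X n x)" if "Q \<in> space (Post \<alpha> M n x)" "n > 0" for Q n
  proof (rule tv_dist_nonneg)
    show "subprob_space Q"
      using that by (simp add: Post_def dirichlet_process_def space_subprob_algebra)
    interpret prob_space "empirical_measure X n x"
      using that xX by (intro prob_space_empirical_measure) auto
    show "subprob_space (empirical_measure X n x)" by unfold_locales
  qed
  show "weak_conv_m
      (\<lambda>n. distr (Post \<alpha> M n x) borel (\<lambda>Q. tv_dist X Q (empirical_measure X n x))) (return borel 0)"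
  proof (rule weak_conv_m_return_0_if_expectation_tendsto_0)
    show "\<forall>\<^sub>F n in sequentially. prob_space (Post \<alpha> M n x) \<and>
        integrable (Post \<alpha> M n x) (\<lambda>Q. tv_dist X Q (empirical_measure X n x)) \<and>
        (\<forall>Q\<in>space (Post \<alpha> M n x). 0 \<le> tv_dist X Q (empirical_measure X n x))"
      using eventually_gt_at_top[of 0]
    proof (rule eventually_mono, intro conjI ballI)
      fix n :: nat assume n: "0 < n"
      show "prob_space (Post \<alpha> M n x)"
        unfolding Post_def using n M
        by (intro prob_space_dirichlet_process prob_space_posterior_mean[OF \<alpha>] xX) auto
      show "integrable (Post \<alpha> M n x) (\<lambda>Q. tv_dist X Q (empirical_measure X n x))"
        by (rule int[OF n])
    qed (rule nonneg)
    let ?E = "\<lambda>n. \<integral>Q. tv_dist X Q (empirical_measure X n x) \<partial>Post \<alpha> M n x"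
    show "?E \<longlonglongrightarrow> 0"
    proof (rule tendstoI)
      fix e :: real assume e: "e > 0"
      then obtain F where F: "finite F" "F \<subseteq> X"
        and small: "\<forall>\<^sub>F n in sequentially. measure (empirical_measure X n x) (X - F) < e / 2"
        using tight[rule_format, of "e / 2"] by auto
      have "(\<lambda>n. (real (card F) + 1) * (M / (M + real n) + 1 / sqrt (M + real n + 1))) \<longlonglongrightarrow> 0"
        using M by real_asymp
      then have "\<forall>\<^sub>F n in sequentially.
          (real (card F) + 1) * (M / (M + real n) + 1 / sqrt (M + real n + 1)) < e / 2"
        by (rule order_tendstoD(2)) (use e in simp)
      with small eventually_gt_at_top[of 0] show "\<forall>\<^sub>F n in sequentially. dist (?E n) 0 < e"
      proof eventually_elim
        case (elim n)
        have "?E n \<le> (real (card F) + 1) * (M / (M + real n) + 1 / sqrt (M + real n + 1))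
            + measure (empirical_measure X n x) (X - F)"
          by (rule posterior_expected_tv_dist_le(2)[OF assms(1) \<alpha> M elim(2) _ F]) (auto intro: xX)
        moreover have "0 \<le> ?E n" using elim(2) by (intro integral_nonneg_AE AE_I2 nonneg)
        ultimately show ?case using elim(1,3) unfolding dist_real_def by linarith
      qed
    qed
  qed
qed

end
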